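(* Let $(X,\mathcal{B})$ be a spherically complete contractive B$_x$-ball space, with $\mathcal{B}=\{B_x\mid x\in X\}$. If a function $f:X\to X$ satisfies $f(x)\in B_x$ for all $x\in X$, then $f$ has a fixed point in every ball $B\in\mathcal{B}$.
   Context: A ball space $(X,\mathcal{B})$ consists of a nonempty set $X$ and a nonempty family $\mathcal{B}$ of nonempty subsets of $X$, called balls. A nest of balls is a nonempty subset of $\mathcal{B}$ which is totally ordered by inclusion. $(X,\mathcal{B})$ is spherically complete if every nest of balls has nonempty intersection. A ball space $(X,\mathcal{B})$ is a B$_x$-ball space if there is a function $X\ni x\mapsto B_x\in\mathcal{B}$ such that $\mathcal{B}=\{B_x\mid x\in X\}$. (It is not required that $x\in B_x$.) A B$_x$-ball space is contractive if: (C1) for all $x\in X$, if $y\in B_x$, then $B_y\subseteq B_x$; (C2) for all $x\in X$, if $B_x$ is not a singleton, then there exists $y\in B_x$ such that $B_y\subsetneq B_x$. *)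

theory Defs
  imports "HOL-Library.FuncSet"
begin

definition ball_space :: "'a set \<Rightarrow> 'a set set \<Rightarrow> bool" where
  "ball_space X \<B> \<longleftrightarrow> X \<noteq> {} \<and> \<B> \<noteq> {} \<and> (\<forall>B\<in>\<B>. B \<noteq> {} \<and> B \<subseteq> X)"

definition nest :: "'a set set \<Rightarrow> 'a set set \<Rightarrow> bool" where
  "nest \<B> \<N> \<longleftrightarrow> \<N> \<noteq> {} \<and> subset.chain \<B> \<N>"

definition spherically_complete :: "'a set \<Rightarrow> 'a set set \<Rightarrow> bool" where
  "spherically_complete X \<B> \<longleftrightarrow> ball_space X \<B> \<and> (\<forall>\<N>. nest \<B> \<N> \<longrightarrow> \<Inter>\<N> \<noteq> {})"

text \<open>The assignment of balls to points is an explicit parameter \<open>Bx\<close>; its values outside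
  \<open>X\<close> are irrelevant. It is not required that \<open>x \<in> Bx x\<close>.\<close>

definition Bx_ball_space :: "'a set \<Rightarrow> 'a set set \<Rightarrow> ('a \<Rightarrow> 'a set) \<Rightarrow> bool" where
  "Bx_ball_space X \<B> Bx \<longleftrightarrow> ball_space X \<B> \<and> \<B> = {Bx x | x. x \<in> X}"

definition contractive :: "'a set \<Rightarrow> 'a set set \<Rightarrow> ('a \<Rightarrow> 'a set) \<Rightarrow> bool" where
  "contractive X \<B> Bx \<longleftrightarrow> Bx_ball_space X \<B> Bx \<and>
     (\<forall>x\<in>X. \<forall>y\<in>Bx x. Bx y \<subseteq> Bx x) \<and>
     (\<forall>x\<in>X. \<not> is_singleton (Bx x) \<longrightarrow> (\<exists>y\<in>Bx x. Bx y \<subset> Bx x))"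

end

theory Submission
  imports Defs
begin

text \<open>Every ball contains a singleton ball (\<open>contractive_contains_singleton_ball\<close>); this is where
  spherical completeness and (C2) enter. Granting it, let \<open>Bx z = {a}\<close> lie inside the given ball.
  By (C1), \<open>Bx a \<subseteq> {a}\<close>, and \<open>f a \<in> Bx a\<close> leaves only \<open>f a = a\<close>.\<close>

text \<open>Below a given ball there is a maximal nest, by Hausdorff's principle, and spherical
  completeness supplies a point \<open>z\<close> in all its members. By (C1), \<open>Bx z\<close> lies below the whole nest;
  were it not a singleton, (C2) would provide a strictly smaller ball, and that ball would properly
  extend the nest.\<close>
lemma contractive_contains_singleton_ball:
  assumes contr: "contractive X \<B> Bx"
    and sc: "spherically_complete X \<B>"
    and B: "B \<in> \<B>"
  obtains z a where "z \<in> X" "Bx z = {a}" "a \<in> B"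
proof -
  have balls: "\<B> = Bx ` X" and sub: "\<And>C. C \<in> \<B> \<Longrightarrow> C \<subseteq> X"
    using contr by (auto simp: contractive_def Bx_ball_space_def ball_space_def)
  have C1: "Bx y \<subseteq> C" if "C \<in> \<B>" "y \<in> C" for C y
    using contr that balls by (auto simp: contractive_def)
  have C2: "\<exists>y\<in>Bx x. Bx y \<subset> Bx x" if "x \<in> X" "\<not> is_singleton (Bx x)" for x
    using contr that by (auto simp: contractive_def)

  define \<A> where "\<A> = {C \<in> \<B>. C \<subseteq> B}"
  obtain \<N> where "subset.maxchain \<A> \<N>"
    using subset.Hausdorff[of \<A>] by (elim exE)
  then have chain: "subset.chain \<A> \<N>"
    and maximal: "\<And>\<M>. subset.chain \<A> \<M> \<Longrightarrow> \<not> \<N> \<subset> \<M>"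
    by (simp_all add: subset.maxchain_def)
  have memb: "C \<in> \<N>" if "C \<in> \<A>" "\<And>D. D \<in> \<N> \<Longrightarrow> C \<subseteq> D" for C
  proof -
    have "subset.chain \<A> (insert C \<N>)"
      using chain that by (auto simp: subset_chain_def)
    with maximal show ?thesis by blast
  qed
  have "B \<in> \<A>"
    using B by (simp add: \<A>_def)
  \<comment> \<open>Nests are nonempty by definition, chains are not: were \<open>\<N>\<close> empty, \<open>B\<close> would extend it.\<close>
  with memb have "\<N> \<noteq> {}" by blast
  moreover have "subset.chain \<B> \<N>"
    using chain by (auto simp: subset_chain_def \<A>_def)
  ultimately have "\<Inter>\<N> \<noteq> {}"
    using sc by (simp add: spherically_complete_def nest_def)
  then obtain z where z: "\<And>C. C \<in> \<N> \<Longrightarrow> z \<in> C"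
    by auto
  have N: "C \<in> \<B>" "C \<subseteq> B" if "C \<in> \<N>" for C
    using chain that by (auto simp: subset_chain_def \<A>_def)
  have below: "Bx z \<subseteq> C" if "C \<in> \<N>" for C
    using C1[of C z] N(1) z that by simp
  have zX: "z \<in> X" and zB: "Bx z \<subseteq> B"
  proof -
    obtain C where "C \<in> \<N>"
      using \<open>\<N> \<noteq> {}\<close> by blast
    then show "z \<in> X" "Bx z \<subseteq> B"
      using N[of C] z[of C] sub[of C] below[of C] by auto
  qed

  have "is_singleton (Bx z)"
  proof (rule ccontr)
    assume "\<not> is_singleton (Bx z)"
    then obtain y where y: "y \<in> Bx z" "Bx y \<subset> Bx z"
      using C2[of z] zX by blast
    have "y \<in> X"
      using y(1) zX sub[of "Bx z"] balls by auto
    then have "Bx y \<in> \<A>"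
      using y(2) zB balls by (auto simp: \<A>_def)
    then have "Bx y \<in> \<N>"
      using memb[of "Bx y"] below y(2) by blast
    then show False
      using below[of "Bx y"] y(2) by blast
  qed
  then obtain a where "Bx z = {a}"
    by (auto simp: is_singleton_def)
  with zX zB show ?thesis
    using that by blast
qed

theorem theorem2p10:
  fixes X :: "'a set" and \<B> :: "'a set set" and Bx :: "'a \<Rightarrow> 'a set" and f :: "'a \<Rightarrow> 'a"
  assumes "contractive X \<B> Bx"
    and "spherically_complete X \<B>"
    and "f \<in> X \<rightarrow> X"
    and "\<And>x. x \<in> X \<Longrightarrow> f x \<in> Bx x"
  shows "\<forall>B\<in>\<B>. \<exists>x\<in>B. f x = x"
proof
  fix B assume "B \<in> \<B>"
  then obtain z a where z: "z \<in> X" "Bx z = {a}" and a: "a \<in> B"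
    using contractive_contains_singleton_ball[OF assms(1,2)] by blast
  have "a \<in> X"
    using assms(1) \<open>B \<in> \<B>\<close> a by (auto simp: contractive_def Bx_ball_space_def ball_space_def)
  moreover have "Bx a \<subseteq> {a}"
    using assms(1) z unfolding contractive_def by force
  ultimately have "f a = a"
    using assms(4) by blast
  with a show "\<exists>x\<in>B. f x = x" by blast
qed

end
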